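(* Let $A$ and $B(\lambda_1,\lambda_2)$ be the matrices defined in the context and consider the bipartite digraph of the associated mean-payoff game. For any elementary cycle $\gamma$ in this digraph, $k_1(\gamma)\le 2$, $k_2(\gamma)\le 2$, and $k_1(\gamma)+k_2(\gamma)\le 2$.
   Context: $\mathbb{R}_{\max}=\mathbb{R}\cup\{-\infty\}$; for a vector $q$, $q^-$ is the row vector with entries $-q_j$. Given $p_1,p_2\in\mathbb{R}_{\max}^n$, $q_1,q_2\in(\mathbb{R}\cup\{+\infty\})^n$, $U,V\in\mathbb{R}_{\max}^{m\times n}$, $b,d\in\mathbb{R}_{\max}^m$ and parameters $(\lambda_1,\lambda_2)\in\mathbb{R}^2$, the $(m+2n+2)\times(n+1)$ matrices are $$A=\begin{pmatrix} U & b\\ -\infty & p_1\\ q_1^- & -\infty\\ -\infty & p_2\\ q_2^- & -\infty\end{pmatrix},\qquad B(\lambda_1,\lambda_2)=\begin{pmatrix} V & d\\ \lambda_1 I & -\infty\\ -\infty & \lambda_1\\ \lambda_2 I & -\infty\\ -\infty & \lambda_2\end{pmatrix},$$ with row groups $C_1,C_2,C_3,C_4,C_5$ of sizes $m,n,1,n,1$ and column groups of sizes $n,1$ (blocks "$-\infty$" filled with $-\infty$; $\lambda I$ has $\lambda$ on the diagonal and $-\infty$ elsewhere). The bipartite digraph of the game has the rows as Max nodes and the columns as Min nodes. There is an arc from Min node $j$ to Max node $i$ (weight $-a_{ij}$) whenever $a_{ij}\ne-\infty$, and an arc from Max node $i$ to Min node $j$ (weight $b_{ij}$) whenever $b_{ij}\neq-\infty$.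 An elementary cycle is a directed cycle visiting no node more than once. $k_1(\gamma)$ is the number of arcs of $\gamma$ carrying the parameter weight $\lambda_1$, i.e. arcs of $\gamma$ leaving Max nodes in $C_2\cup C_3$; $k_2(\gamma)$ is the number of arcs of $\gamma$ carrying the parameter weight $\lambda_2$, i.e. arcs of $\gamma$ leaving Max nodes in $C_4\cup C_5$. *)

theory Defs
  imports
    "Graph_Theory.Arc_Walk"
    "HOL-Analysis.Finite_Cartesian_Product"
    "HOL-Library.Extended_Real"
begin

section \<open>The digraph of a mean-payoff game\<close>

definition Rmax :: "ereal set" where
  "Rmax = {x. x \<noteq> \<infinity>}"

text \<open>Row indices are the nodes of player Max, column indices those of player Min.\<close>

datatype ('r, 'c) game_node = MaxNode 'r | MinNode 'c

type_synonym ('r, 'c) game_arc = "('r, 'c) game_node \<times> ('r, 'c) game_node"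

definition game_digraph ::
  "ereal ^ 'c ^ 'r \<Rightarrow> ereal ^ 'c ^ 'r \<Rightarrow> (('r, 'c) game_node, ('r, 'c) game_arc) pre_digraph" where
  "game_digraph A B =
     \<lparr> verts = UNIV,
       arcs = {(MinNode j, MaxNode i) | i j. A $ i $ j \<noteq> -\<infinity>} \<union>
              {(MaxNode i, MinNode j) | i j. B $ i $ j \<noteq> -\<infinity>},
       tail = fst,
       head = snd \<rparr>"

text \<open>Only the values on arcs of the digraph are meaningful.\<close>

fun game_weight :: "ereal ^ 'c ^ 'r \<Rightarrow> ereal ^ 'c ^ 'r \<Rightarrow> ('r, 'c) game_arc \<Rightarrow> ereal" where
  "game_weight A B (MinNode j, MaxNode i) = - (A $ i $ j)"
| "game_weight A B (MaxNode i, MinNode j) = B $ i $ j"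
| "game_weight A B _ = undefined"


section \<open>The parametric pair of matrices\<close>

text \<open>
  The constructors are the row groups, of sizes $m$, $n$, $1$, $n$, $1$ for
  $m$ and $n$ the cardinalities of the two index types, and the column groups,
  of sizes $n$, $1$.
\<close>

datatype ('m, 'n) row = C1 'm | C2 'n | C3 | C4 'n | C5

datatype 'n col = Col 'n | LastCol

lemma UNIV_row:
  "(UNIV :: ('m, 'n) row set) = range C1 \<union> (range C2 \<union> (range C4 \<union> {C3, C5}))"
proof -
  have "x \<in> range C1 \<union> (range C2 \<union> (range C4 \<union> {C3, C5}))" for x :: "('m, 'n) row"
    by (cases x) auto
  then show ?thesis by blast
qed

lemma UNIV_col: "(UNIV :: 'n col set) = insert LastCol (range Col)"
proof -
  have "x \<in> insert LastCol (range Col)" for x :: "'n col"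
    by (cases x) auto
  then show ?thesis by blast
qed

instance row :: (finite, finite) finite
  by standard (simp add: UNIV_row)

instance col :: (finite) finite
  by standard (simp add: UNIV_col)

lemma card_row: "CARD(('m::finite, 'n::finite) row) = CARD('m) + 2 * CARD('n) + 2"
proof -
  have "CARD(('m, 'n) row) =
      card (range (C1 :: 'm \<Rightarrow> ('m, 'n) row)) +
      (card (range (C2 :: 'n \<Rightarrow> ('m, 'n) row)) +
        (card (range (C4 :: 'n \<Rightarrow> ('m, 'n) row)) + card {C3, C5 :: ('m, 'n) row}))"
    unfolding UNIV_row
    by (subst card_Un_disjoint, simp, simp, blast)+ simp
  then show ?thesis
    by (simp add: card_image inj_on_def)
qed

lemma card_col: "CARD('n::finite col) = CARD('n) + 1"
  unfolding UNIV_col by (subst card_insert_disjoint) (auto simp: card_image inj_on_def)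

definition matA ::
  "ereal ^ 'n ^ 'm \<Rightarrow> ereal ^ 'm \<Rightarrow> ereal ^ 'n \<Rightarrow> ereal ^ 'n \<Rightarrow> ereal ^ 'n \<Rightarrow> ereal ^ 'n
     \<Rightarrow> ereal ^ ('n col) ^ (('m, 'n) row)" where
  "matA U b p1 q1 p2 q2 = (\<chi> i j.
     case i of
       C1 r \<Rightarrow> (case j of Col c \<Rightarrow> U $ r $ c   | LastCol \<Rightarrow> b $ r)
     | C2 r \<Rightarrow> (case j of Col c \<Rightarrow> -\<infinity>          | LastCol \<Rightarrow> p1 $ r)
     | C3   \<Rightarrow> (case j of Col c \<Rightarrow> - (q1 $ c)  | LastCol \<Rightarrow> -\<infinity>)
     | C4 r \<Rightarrow> (case j of Col c \<Rightarrow> -\<infinity>          | LastCol \<Rightarrow> p2 $ r)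
     | C5   \<Rightarrow> (case j of Col c \<Rightarrow> - (q2 $ c)  | LastCol \<Rightarrow> -\<infinity>))"

definition matB ::
  "ereal ^ 'n ^ 'm \<Rightarrow> ereal ^ 'm \<Rightarrow> real \<Rightarrow> real \<Rightarrow> ereal ^ ('n col) ^ (('m, 'n) row)" where
  "matB V d l1 l2 = (\<chi> i j.
     case i of
       C1 r \<Rightarrow> (case j of Col c \<Rightarrow> V $ r $ c                         | LastCol \<Rightarrow> d $ r)
     | C2 r \<Rightarrow> (case j of Col c \<Rightarrow> (if r = c then ereal l1 else -\<infinity>)  | LastCol \<Rightarrow> -\<infinity>)
     | C3   \<Rightarrow> (case j of Col c \<Rightarrow> -\<infinity>                                | LastCol \<Rightarrow> ereal l1)
     | C4 r \<Rightarrow> (case j of Col c \<Rightarrow> (if r = c then ereal l2 else -\<infinity>)  | LastCol \<Rightarrow> -\<infinity>)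
     | C5   \<Rightarrow> (case j of Col c \<Rightarrow> -\<infinity>                                | LastCol \<Rightarrow> ereal l2))"


section \<open>Numbers of parametric arcs\<close>

text \<open>
  A walk is the list of its arcs, so an arc is counted as often as it is traversed.
  The arcs counted are those of parametric weight by position in the matrix, not by
  value: an entry of $V$ or $d$ that happens to equal a parameter is not counted, and the
  two numbers remain distinct when the parameters coincide.
\<close>

definition k1 :: "(('m, 'n) row, 'n col) game_arc awalk \<Rightarrow> nat" where
  "k1 \<gamma> = length (filter (\<lambda>e. fst e \<in> MaxNode ` (range C2 \<union> {C3})) \<gamma>)"

definition k2 :: "(('m, 'n) row, 'n col) game_arc awalk \<Rightarrow> nat" where
  "k2 \<gamma> = length (filter (\<lambda>e. fst e \<in> MaxNode ` (range C4 \<union> {C5})) \<gamma>)"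

lemma weight_k1_arc:
  assumes "e \<in> arcs (game_digraph A (matB V d l1 l2))"
    and "fst e \<in> MaxNode ` (range C2 \<union> {C3})"
  shows "game_weight A (matB V d l1 l2) e = ereal l1"
  using assms by (auto simp: game_digraph_def matB_def split: col.splits if_splits)

lemma weight_k2_arc:
  assumes "e \<in> arcs (game_digraph A (matB V d l1 l2))"
    and "fst e \<in> MaxNode ` (range C4 \<union> {C5})"
  shows "game_weight A (matB V d l1 l2) e = ereal l2"
  using assms by (auto simp: game_digraph_def matB_def split: col.splits if_splits)

end

theory Submission
  imports Defs "HOL-Library.Multiset"
begin

text \<open>
  Among the rows outside \<^const>\<open>C1\<close>, those in \<^const>\<open>C2\<close> and \<^const>\<open>C4\<close> can be entered only from the
  last column, and those in \<^const>\<open>C3\<close> and \<^const>\<open>C5\<close> can be left only towards it. An elementary cycle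
  passes at most once through the last column, so it has at most one parametric arc of each
  of these two kinds.
\<close>

text \<open>Each side is the multiset of all vertices of the walk: the tails omit only its end
  \<open>v\<close>, the heads only its start \<open>u\<close>.\<close>

lemma (in pre_digraph) cas_mset_tail_head:
  assumes "cas u p v"
  shows "add_mset v (mset (map (tail G) p)) = add_mset u (mset (map (head G) p))"
  using assms by (induction u p v rule: cas.induct) (auto simp: add_mset_commute)

lemma (in pre_digraph) cycle_mset_tail_head:
  assumes "cycle p"
  shows "mset (map (tail G) p) = mset (map (head G) p)"
  using assms cas_mset_tail_head by (fastforce simp: cycle_def awalk_def)

text \<open>For nonempty \<open>p\<close>, dropping the start vertex from
  \<open>awalk_verts u p\<close> leaves exactly the list of heads.\<close>

lemma (in pre_digraph) cycle_distinct_heads: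
  assumes "cycle p"
  shows "distinct (map (head G) p)"
proof -
  obtain u where u: "cas u p u" "distinct (tl (awalk_verts u p))" "p \<noteq> []"
    using assms by (auto simp: cycle_def awalk_def)
  then show ?thesis
    by (simp add: awalk_verts_conv'[OF u(1)])
qed

lemma (in pre_digraph) cycle_distinct_tails:
  assumes "cycle p"
  shows "distinct (map (tail G) p)"
  using cycle_distinct_heads[OF assms] mset_eq_imp_distinct_iff[OF cycle_mset_tail_head[OF assms]]
  by simp

lemma (in pre_digraph) cycle_length_filter_tail_head:
  assumes "cycle p"
  shows "length (filter (\<lambda>e. P (tail G e)) p) = length (filter (\<lambda>e. P (head G e)) p)"
proof -
  have "size (filter_mset P (mset (map (tail G) p))) = size (filter_mset P (mset (map (head G) p)))"
    by (simp only: cycle_mset_tail_head[OF assms])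
  then show ?thesis
    by (simp only: mset_filter[symmetric] size_mset filter_map length_map comp_def)
qed

lemma length_filter_le_one:
  assumes "distinct (map f xs)" and "\<And>x. x \<in> set xs \<Longrightarrow> P x \<Longrightarrow> f x = v"
  shows "length (filter P xs) \<le> 1"
proof -
  have "inj_on f (set (filter P xs))" and "f ` set (filter P xs) \<subseteq> {v}"
    using assms by (auto simp: distinct_map inj_on_def)
  then have "card (set (filter P xs)) \<le> card {v}"
    by (intro card_inj_on_le) auto
  moreover have "distinct (filter P xs)"
    using assms(1) by (simp add: distinct_map)
  ultimately show ?thesis
    by (simp add: distinct_card flip: set_filter)
qed

text \<open>Outside the last column these rows of \<open>matA\<close> are filled with -\<infinity>.
  Arcs into Max nodes come from the first matrix alone, so \<open>B\<close> is arbitrary.\<close>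

lemma arc_into_C2_C4:
  assumes "e \<in> arcs (game_digraph (matA U b p1 q1 p2 q2) B)"
    and "snd e \<in> MaxNode ` (range C2 \<union> range C4)"
  shows "fst e = MinNode LastCol"
  using assms by (auto simp: game_digraph_def matA_def split: col.splits)

text \<open>The only finite entry of these rows of \<open>matB\<close> lies in the last
  column.\<close>

lemma arc_from_C3_C5:
  assumes "e \<in> arcs (game_digraph A (matB V d l1 l2))"
    and "fst e \<in> MaxNode ` {C3, C5}"
  shows "snd e = MinNode LastCol"
  using assms by (auto simp: game_digraph_def matB_def split: col.splits)

text \<open>Regroups the parametric arcs by block shape instead of by parameter, because the bound
  of one holds for each shape.\<close>

lemma k1_plus_k2:
  "k1 \<gamma> + k2 \<gamma> =
     length (filter (\<lambda>e. fst e \<in> MaxNode ` (range C2 \<union> range C4)) \<gamma>) +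
     length (filter (\<lambda>e. fst e \<in> MaxNode ` {C3, C5}) \<gamma>)"
  unfolding k1_def k2_def by (induction \<gamma>) auto

theorem lemma5p1:
  fixes U V :: "ereal ^ 'n::finite ^ 'm::finite"
    and b d :: "ereal ^ 'm"
    and p1 p2 q1 q2 :: "ereal ^ 'n"
    and l1 l2 :: real
    and \<gamma> :: "(('m, 'n) row, 'n col) game_arc awalk"
  assumes "\<And>i j. U $ i $ j \<in> Rmax" and "\<And>i j. V $ i $ j \<in> Rmax"
    and "\<And>i. b $ i \<in> Rmax" and "\<And>i. d $ i \<in> Rmax"
    and "\<And>j. p1 $ j \<in> Rmax" and "\<And>j. p2 $ j \<in> Rmax"
    and "\<And>j. q1 $ j \<noteq> -\<infinity>" and "\<And>j. q2 $ j \<noteq> -\<infinity>"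
    and "pre_digraph.cycle (game_digraph (matA U b p1 q1 p2 q2) (matB V d l1 l2)) \<gamma>"
  shows "k1 \<gamma> \<le> 2 \<and> k2 \<gamma> \<le> 2 \<and> k1 \<gamma> + k2 \<gamma> \<le> 2"
proof -
  let ?G = "game_digraph (matA U b p1 q1 p2 q2) (matB V d l1 l2)"
  interpret pre_digraph ?G .
  have ends: "tail ?G = fst" "head ?G = snd"
    by (simp_all add: game_digraph_def)
  have cyc: "cycle \<gamma>"
    using assms(9) .
  have sub: "e \<in> arcs ?G" if "e \<in> set \<gamma>" for e
    using cyc that by (auto simp: cycle_def awalk_def)
  have "length (filter (\<lambda>e. snd e \<in> MaxNode ` (range C2 \<union> range C4)) \<gamma>) \<le> 1"
    using cycle_distinct_tails[OF cyc] arc_into_C2_C4[OF sub]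
    by (intro length_filter_le_one[where f = fst]) (auto simp only: ends)
  \<comment> \<open>The arcs bounded so far enter these rows, whereas the parametric arcs leave
    them; a cycle does both equally often.\<close>
  then have "length (filter (\<lambda>e. fst e \<in> MaxNode ` (range C2 \<union> range C4)) \<gamma>) \<le> 1"
    using cycle_length_filter_tail_head[OF cyc, of "\<lambda>x. x \<in> MaxNode ` (range C2 \<union> range C4)"]
    by (simp only: ends)
  \<comment> \<open>Here the parametric arcs themselves end in the last column, so distinct heads
    suffice.\<close>
  moreover have "length (filter (\<lambda>e. fst e \<in> MaxNode ` {C3, C5}) \<gamma>) \<le> 1"
    using cycle_distinct_heads[OF cyc] arc_from_C3_C5[OF sub]
    by (intro length_filter_le_one[where f = snd]) (auto simp only: ends)
  ultimately have "k1 \<gamma> + k2 \<gamma> \<le> 2"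
    unfolding k1_plus_k2 by linarith
  then show ?thesis
    by linarith
qed

end
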